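(* Let $T$ be a multiplicatively closed subset of a semiring $S$ and let $I$ be a $k$-ideal of $S$ that is maximal (with respect to inclusion) among the $k$-ideals of $S$ disjoint from $T$. Then $I$ is $k$-prime.
   Context: A semiring is a commutative semiring $(S,+,0,\cdot,1)$ with multiplicative identity $1$ and additive identity $0$ that is absorbing. An ideal is a nonempty subset closed under addition and under multiplication by elements of $S$. A $k$-ideal is an ideal $I$ such that $x+y\in I$ and $y\in I$ imply $x\in I$. A $k$-ideal $I$ is $k$-prime if for all $k$-ideals $A,B$ of $S$, $AB\subseteq I$ implies $A\subseteq I$ or $B\subseteq I$, where $AB$ is the ideal of finite sums of products $ab$ with $a\in A$, $b\in B$. A subset $T$ is multiplicatively closed if $st\in T$ for all $s,t\in T$. *)

theory Defs
  imports Main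
begin

(* Semirings are types of sort {comm_semiring_0, comm_monoid_mult}: commutative, with an
   absorbing 0 and a multiplicative identity 1. The class comm_semiring_1 is not used because
   it also imposes 0 \<noteq> 1. *)

definition semiring_ideal :: "'a::{comm_semiring_0,comm_monoid_mult} set \<Rightarrow> bool" where
  "semiring_ideal I \<longleftrightarrow>
     I \<noteq> {} \<and> (\<forall>x\<in>I. \<forall>y\<in>I. x + y \<in> I) \<and> (\<forall>s. \<forall>x\<in>I. s * x \<in> I)"

definition k_ideal :: "'a::{comm_semiring_0,comm_monoid_mult} set \<Rightarrow> bool" where
  "k_ideal I \<longleftrightarrow> semiring_ideal I \<and> (\<forall>x y. x + y \<in> I \<and> y \<in> I \<longrightarrow> x \<in> I)"

definition ideal_prod ::
  "'a::{comm_semiring_0,comm_monoid_mult} set \<Rightarrow> 'a set \<Rightarrow> 'a set" where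
  "ideal_prod A B =
     {\<Sum>i<n. a i * b i | (n::nat) a b. \<forall>i<n. a i \<in> A \<and> b i \<in> B}"

(* The improper ideal UNIV is k-prime under this definition. *)
definition k_prime :: "'a::{comm_semiring_0,comm_monoid_mult} set \<Rightarrow> bool" where
  "k_prime I \<longleftrightarrow> k_ideal I \<and>
     (\<forall>A B. k_ideal A \<longrightarrow> k_ideal B \<longrightarrow> ideal_prod A B \<subseteq> I \<longrightarrow> A \<subseteq> I \<or> B \<subseteq> I)"

(* Neither 1 \<in> T nor nonemptiness of T is required. *)
definition mult_closed :: "'a::{comm_semiring_0,comm_monoid_mult} set \<Rightarrow> bool" where
  "mult_closed T \<longleftrightarrow> (\<forall>s\<in>T. \<forall>t\<in>T. s * t \<in> T)"

end

theory Submission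
  imports Defs
begin

text \<open>
  If \<open>A\<close> and \<open>B\<close> are \<open>k\<close>-ideals not contained in \<open>I\<close>, then by maximality the \<open>k\<close>-closures of
  \<open>I + A\<close> and \<open>I + B\<close> contain elements \<open>s\<close> and \<open>t\<close> of \<open>T\<close>. When \<open>A B \<subseteq> I\<close>, every product
  of an element of \<open>I + A\<close> and one of \<open>I + B\<close> lies in \<open>I\<close>; since \<open>I\<close> is a \<open>k\<close>-ideal, this
  passes to the \<open>k\<close>-closures in each factor, so \<open>s * t \<in> I \<inter> T\<close>.
\<close>

text \<open>For an ideal \<open>I\<close> this is the least \<open>k\<close>-ideal containing it:
  the elements that cancellation against \<open>I\<close> forces in, and a single round of
  cancelling is enough.\<close>

definition k_closure :: "'a::{comm_semiring_0,comm_monoid_mult} set \<Rightarrow> 'a set" where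
  "k_closure I = {x. \<exists>y\<in>I. x + y \<in> I}"

definition ideal_sum :: "'a::{comm_semiring_0,comm_monoid_mult} set \<Rightarrow> 'a set \<Rightarrow> 'a set" where
  "ideal_sum A B = {a + b | a b. a \<in> A \<and> b \<in> B}"

lemma semiring_ideal_add: "semiring_ideal I \<Longrightarrow> x \<in> I \<Longrightarrow> y \<in> I \<Longrightarrow> x + y \<in> I"
  by (auto simp: semiring_ideal_def)

lemma semiring_ideal_mult: "semiring_ideal I \<Longrightarrow> x \<in> I \<Longrightarrow> s * x \<in> I"
  by (auto simp: semiring_ideal_def)

lemma semiring_ideal_zero:
  assumes "semiring_ideal I"
  shows "0 \<in> I"
proof -
  obtain x where "x \<in> I" using assms by (auto simp: semiring_ideal_def)
  then have "0 * x \<in> I" using semiring_ideal_mult[OF assms] by blast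
  then show ?thesis by simp
qed

lemma k_ideal_semiring_ideal: "k_ideal I \<Longrightarrow> semiring_ideal I"
  by (simp add: k_ideal_def)

lemma k_ideal_cancel: "k_ideal I \<Longrightarrow> x + y \<in> I \<Longrightarrow> y \<in> I \<Longrightarrow> x \<in> I"
  unfolding k_ideal_def by blast

lemma semiring_ideal_ideal_sum:
  assumes "semiring_ideal A" "semiring_ideal B"
  shows "semiring_ideal (ideal_sum A B)"
  unfolding semiring_ideal_def
proof (intro conjI ballI allI)
  show "ideal_sum A B \<noteq> {}"
    using assms semiring_ideal_zero by (auto simp: ideal_sum_def)
next
  fix x y assume "x \<in> ideal_sum A B" "y \<in> ideal_sum A B"
  then obtain a b c d where "x = a + b" "y = c + d" and *: "a \<in> A" "b \<in> B" "c \<in> A" "d \<in> B"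
    by (auto simp: ideal_sum_def)
  then have "x + y = (a + c) + (b + d)" by (simp add: ac_simps)
  with * show "x + y \<in> ideal_sum A B"
    using assms semiring_ideal_add unfolding ideal_sum_def by blast
next
  fix s x assume "x \<in> ideal_sum A B"
  then show "s * x \<in> ideal_sum A B"
    using assms semiring_ideal_mult unfolding ideal_sum_def by (fastforce simp: distrib_left)
qed

lemma ideal_sum_upper1: "semiring_ideal B \<Longrightarrow> A \<subseteq> ideal_sum A B"
  unfolding ideal_sum_def by clarify (metis semiring_ideal_zero add_0_right)

lemma ideal_sum_upper2: "semiring_ideal A \<Longrightarrow> B \<subseteq> ideal_sum A B"
  unfolding ideal_sum_def by clarify (metis semiring_ideal_zero add_0_left)

lemma k_closure_upper:
  assumes "semiring_ideal I"
  shows "I \<subseteq> k_closure I"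
  using semiring_ideal_add[OF assms] by (auto simp: k_closure_def)

lemma k_ideal_k_closure:
  assumes I: "semiring_ideal I"
  shows "k_ideal (k_closure I)"
  unfolding k_ideal_def semiring_ideal_def
proof (intro conjI ballI allI impI)
  show "k_closure I \<noteq> {}"
    using k_closure_upper[OF I] semiring_ideal_zero[OF I] by blast
next
  fix x y assume "x \<in> k_closure I" "y \<in> k_closure I"
  then obtain u v where uv: "u \<in> I" "x + u \<in> I" "v \<in> I" "y + v \<in> I"
    by (auto simp: k_closure_def)
  then have "(x + u) + (y + v) \<in> I" "u + v \<in> I" using semiring_ideal_add[OF I] by blast+
  moreover have "(x + u) + (y + v) = (x + y) + (u + v)" by (simp add: ac_simps)
  ultimately show "x + y \<in> k_closure I" by (auto simp: k_closure_def)
next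
  fix s x assume "x \<in> k_closure I"
  then obtain u where "u \<in> I" "x + u \<in> I" by (auto simp: k_closure_def)
  then have "s * u \<in> I" "s * x + s * u \<in> I"
    using semiring_ideal_mult[OF I] by (auto simp flip: distrib_left)
  then show "s * x \<in> k_closure I" by (auto simp: k_closure_def)
next
  fix x y assume "x + y \<in> k_closure I \<and> y \<in> k_closure I"
  then obtain u v where uv: "u \<in> I" "x + y + u \<in> I" "v \<in> I" "y + v \<in> I"
    by (auto simp: k_closure_def)
  \<comment> \<open>Cancelling \<open>y\<close> costs no second closure step:
    \<open>(y + v) + u\<close> already lies in \<open>I\<close> and serves as the witness for
    \<open>x\<close>.\<close>
  then have "(x + y + u) + v \<in> I" "(y + v) + u \<in> I" using semiring_ideal_add[OF I] by blast+
  moreover have "(x + y + u) + v = x + ((y + v) + u)" by (simp add: ac_simps)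
  ultimately show "x \<in> k_closure I" by (auto simp: k_closure_def)
qed

text \<open>Multiplying \<open>x + u\<close> by \<open>c\<close> gives \<open>x * c + u * c\<close>,
  from which \<open>u * c\<close> can be cancelled inside \<open>K\<close>. Only one factor is
  enlarged at a time, so a product of two closures takes two applications.\<close>

lemma mult_k_closure_in_k_ideal:
  assumes "k_ideal K" "\<And>u. u \<in> L \<Longrightarrow> u * c \<in> K" "x \<in> k_closure L"
  shows "x * c \<in> K"
proof -
  obtain u where u: "u \<in> L" "x + u \<in> L" using assms(3) by (auto simp: k_closure_def)
  from assms(2)[OF u(2)] have "x * c + u * c \<in> K" by (simp add: distrib_right)
  then show ?thesis using k_ideal_cancel[OF assms(1)] assms(2)[OF u(1)] by blast
qed

lemma mult_in_ideal_prod: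
  assumes "a \<in> A" "b \<in> B"
  shows "a * b \<in> ideal_prod A B"
proof -
  have "a * b = (\<Sum>i<Suc 0. a * b)" by simp
  with assms show ?thesis
    unfolding ideal_prod_def
    by (intro CollectI exI[of _ "Suc 0"] exI[of _ "\<lambda>_. a"] exI[of _ "\<lambda>_. b"]) simp
qed

text \<open>In the expansion of \<open>(i + a) * (j + b)\<close> every term has a factor in
  \<open>I\<close> except \<open>a * b\<close>, which lies in the product ideal.\<close>

lemma mult_ideal_sum_in_ideal:
  assumes I: "semiring_ideal I" and "ideal_prod A B \<subseteq> I"
    and "x \<in> ideal_sum I A" "y \<in> ideal_sum I B"
  shows "x * y \<in> I"
proof -
  obtain i a j b where xy: "x = i + a" "y = j + b" "i \<in> I" "a \<in> A" "j \<in> I" "b \<in> B"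
    using assms(3,4) by (auto simp: ideal_sum_def)
  have "a * b \<in> I" using mult_in_ideal_prod assms(2) xy(4,6) by blast
  moreover have "x * j \<in> I" "b * i \<in> I" using semiring_ideal_mult[OF I] xy by blast+
  ultimately have "x * j + (b * i + a * b) \<in> I" using semiring_ideal_add[OF I] by blast
  moreover have "x * y = x * j + (b * i + a * b)"
    unfolding xy by (simp add: distrib_left distrib_right ac_simps)
  ultimately show ?thesis by simp
qed

theorem proposition3p8:
  fixes T I :: "'a::{comm_semiring_0,comm_monoid_mult} set"
  assumes "mult_closed T"
    and "k_ideal I"
    and "I \<inter> T = {}"
    and "\<And>J. k_ideal J \<Longrightarrow> J \<inter> T = {} \<Longrightarrow> I \<subseteq> J \<Longrightarrow> J = I"
  shows "k_prime I"
proof -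
  note I = k_ideal_semiring_ideal[OF assms(2)]
  \<comment> \<open>Otherwise maximality would make the closure equal to \<open>I\<close>, although
    it contains \<open>A\<close>.\<close>
  have meets: "\<exists>t\<in>T. t \<in> k_closure (ideal_sum I A)" if "k_ideal A" "\<not> A \<subseteq> I" for A
  proof (rule ccontr)
    let ?J = "k_closure (ideal_sum I A)"
    assume "\<not> ?thesis"
    then have disj: "?J \<inter> T = {}" by blast
    note A = k_ideal_semiring_ideal[OF that(1)]
    note sum = semiring_ideal_ideal_sum[OF I A]
    have "I \<subseteq> ?J" "A \<subseteq> ?J"
      using ideal_sum_upper1[OF A] ideal_sum_upper2[OF I] k_closure_upper[OF sum] by blast+
    then show False using assms(4)[OF k_ideal_k_closure[OF sum] disj] that(2) by blast
  qed
  have "A \<subseteq> I \<or> B \<subseteq> I" if "k_ideal A" "k_ideal B" "ideal_prod A B \<subseteq> I" for A B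
  proof (rule ccontr)
    assume "\<not> ?thesis"
    then have "\<not> A \<subseteq> I" "\<not> B \<subseteq> I" by blast+
    then obtain s t where s: "s \<in> T" "s \<in> k_closure (ideal_sum I A)"
      and t: "t \<in> T" "t \<in> k_closure (ideal_sum I B)"
      using meets[OF \<open>k_ideal A\<close>] meets[OF \<open>k_ideal B\<close>] by blast
    \<comment> \<open>First pass: \<open>y\<close> stays fixed in the sum while the left factor
      moves from \<open>ideal_sum I A\<close> to its closure.\<close>
    have "s * y \<in> I" if "y \<in> ideal_sum I B" for y
      using mult_k_closure_in_k_ideal[OF assms(2) _ s(2)]
        mult_ideal_sum_in_ideal[OF I \<open>ideal_prod A B \<subseteq> I\<close> _ that] by blast
    \<comment> \<open>Second pass: now \<open>s\<close> is the fixed factor, and commutativity puts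
      the varying factor on the left.\<close>
    then have "t * s \<in> I"
      using mult_k_closure_in_k_ideal[OF assms(2) _ t(2)] by (metis mult.commute)
    moreover have "t * s \<in> T" using assms(1) s(1) t(1) by (auto simp: mult_closed_def)
    ultimately show False using assms(3) by blast
  qed
  then show ?thesis using assms(2) by (auto simp: k_prime_def)
qed

end
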